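(* Let $L, R$ be subsets of a group $G$ such that $(L,R)$ has the $2$S-Cayley property, and let $D(G)$ denote the set of all derangements of $G$. Then the following hold. $(\hat 1)$ Given $\ell\in L$, $r\in R$, for each $x\in G$ there exist unique $\ell'\in L$, $r'\in R$ such that $\varphi:=\lambda_{\ell,r}\circ\lambda_{\ell',r'}$ fixes $x$. Moreover $\varphi=\mathrm{id}$ if and only if $L\ell\cap Rr\cap Z(G)\neq\varnothing$. $(\hat 2)$ $\hat{S}(L,R)\subseteq D(G)$. $(\hat 3)$ $(\hat{S}(L,R)\circ \hat{S}(L,R)^{-1})\setminus \{\mathrm{id}\}\subseteq D(G)$.
   Context: Let $G$ be a group with identity $e$ and centre $Z(G)$; for $X\subseteq G$ and $g\in G$ write $X^{-1}=\{x^{-1}: x\in X\}$, $X^g=g^{-1}Xg$, and $XY=\{xy: x\in X, y\in Y\}$; $L\ell=\{a\ell: a\in L\}$. For $\ell,r\in G$, $\lambda_{\ell,r}$ is the permutation $g\mapsto \ell^{-1}gr$ of $G$. Permutations act on the right, so $\alpha\circ\beta$ means first $\alpha$, then $\beta$. The connection set is $\hat S(L,R)=\{\lambda_{\ell,r}: (\ell,r)\in L\times R\}$, with $\hat S(L,R)^{-1}=\{\lambda^{-1}:\lambda\in\hat S(L,R)\}$, and $A\circ B=\{\alpha\circ\beta:\alpha\in A,\beta\in B\}$ for sets of permutations. A derangement of $G$ is a permutation of the set $G$ with no fixed points. A pair $(L,R)$ of subsets of $G$ has the $2$S-Cayley property if both $L,R$ are non-empty and: (1) $L^{-1}gR=LgR^{-1}$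 for each $g\in G$; (2) $L^g\cap R=\varnothing$ for each $g\in G$; (3) $(LL^{-1})^g\cap (RR^{-1})=\{e\}$ for each $g\in G$. *)

theory Defs
  imports "HOL-Algebra.Coset" "HOL-Algebra.Bij"
begin

text \<open>
  Permutations of the underlying set of \<open>G\<close> are the elements of \<^const>\<open>Bij\<close>, that is, they are
  \<^const>\<open>undefined\<close> outside of \<open>carrier G\<close>; identity and inverses are those of \<^const>\<open>BijGroup\<close>.
\<close>

definition lr_perm :: "('a, 'b) monoid_scheme \<Rightarrow> 'a \<Rightarrow> 'a \<Rightarrow> 'a \<Rightarrow> 'a" where
  "lr_perm G l r = (\<lambda>g\<in>carrier G. inv\<^bsub>G\<^esub> l \<otimes>\<^bsub>G\<^esub> g \<otimes>\<^bsub>G\<^esub> r)"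

text \<open>
  Permutations act on the right: \<open>perm_comp G \<alpha> \<beta>\<close> is first \<open>\<alpha>\<close>, then \<open>\<beta>\<close>, whereas the product of
  \<^const>\<open>BijGroup\<close> applies its second factor first.
\<close>

definition perm_comp ::
    "('a, 'b) monoid_scheme \<Rightarrow> ('a \<Rightarrow> 'a) \<Rightarrow> ('a \<Rightarrow> 'a) \<Rightarrow> 'a \<Rightarrow> 'a" where
  "perm_comp G \<alpha> \<beta> = \<beta> \<otimes>\<^bsub>BijGroup (carrier G)\<^esub> \<alpha>"

definition perm_set_comp ::
    "('a, 'b) monoid_scheme \<Rightarrow> ('a \<Rightarrow> 'a) set \<Rightarrow> ('a \<Rightarrow> 'a) set \<Rightarrow> ('a \<Rightarrow> 'a) set" where
  "perm_set_comp G A B = {perm_comp G \<alpha> \<beta> | \<alpha> \<beta>. \<alpha> \<in> A \<and> \<beta> \<in> B}"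

definition connection_set ::
    "('a, 'b) monoid_scheme \<Rightarrow> 'a set \<Rightarrow> 'a set \<Rightarrow> ('a \<Rightarrow> 'a) set" where
  "connection_set G L R = {lr_perm G l r | l r. l \<in> L \<and> r \<in> R}"

definition derangements :: "('a, 'b) monoid_scheme \<Rightarrow> ('a \<Rightarrow> 'a) set" where
  "derangements G = {\<sigma> \<in> Bij (carrier G). \<forall>x\<in>carrier G. \<sigma> x \<noteq> x}"

definition centre :: "('a, 'b) monoid_scheme \<Rightarrow> 'a set" where
  "centre G = {z \<in> carrier G. \<forall>g\<in>carrier G. z \<otimes>\<^bsub>G\<^esub> g = g \<otimes>\<^bsub>G\<^esub> z}"

definition conj_set :: "('a, 'b) monoid_scheme \<Rightarrow> 'a set \<Rightarrow> 'a \<Rightarrow> 'a set" where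
  "conj_set G X g = (inv\<^bsub>G\<^esub> g <#\<^bsub>G\<^esub> X) #>\<^bsub>G\<^esub> g"

definition two_S_Cayley :: "('a, 'b) monoid_scheme \<Rightarrow> 'a set \<Rightarrow> 'a set \<Rightarrow> bool" where
  "two_S_Cayley G L R \<longleftrightarrow>
     L \<noteq> {} \<and> R \<noteq> {} \<and>
     (\<forall>g\<in>carrier G. ((set_inv\<^bsub>G\<^esub> L) #>\<^bsub>G\<^esub> g) <#>\<^bsub>G\<^esub> R = (L #>\<^bsub>G\<^esub> g) <#>\<^bsub>G\<^esub> (set_inv\<^bsub>G\<^esub> R)) \<and>
     (\<forall>g\<in>carrier G. conj_set G L g \<inter> R = {}) \<and>
     (\<forall>g\<in>carrier G. conj_set G (L <#>\<^bsub>G\<^esub> (set_inv\<^bsub>G\<^esub> L)) g \<inter> (R <#>\<^bsub>G\<^esub> (set_inv\<^bsub>G\<^esub> R)) = {\<one>\<^bsub>G\<^esub>})"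

end

theory Submission
  imports Defs
begin

text \<open>
  Everything follows from reading the axioms of \<^const>\<open>two_S_Cayley\<close> at a single point. Write
  \<open>\<lambda>(l,r)\<close> for \<open>lr_perm G l r\<close>. That no conjugate of \<open>L\<close> meets \<open>R\<close> means that no equation
  \<open>l\<inverse> x r = x\<close> has a solution with \<open>l \<in> L\<close>, \<open>r \<in> R\<close>, so the connection set consists of derangements.
  That the conjugates of \<open>LL\<inverse>\<close> meet \<open>RR\<inverse>\<close> only in \<open>\<one>\<close> means that \<open>(l, r) \<mapsto> l\<inverse> x r\<close> is injective
  on \<open>L \<times> R\<close> for every \<open>x\<close> (\<open>two_S_Cayley_inj\<close>). Hence two members \<open>\<alpha>\<close>, \<open>\<beta>\<close> of the connection set
  which agree at one point are equal, which is the claim on the quotients \<open>\<alpha> \<beta>\<inverse>\<close>.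

  For products of two members, \<open>\<lambda>(l,r)\<close> followed by \<open>\<lambda>(l',r')\<close> fixes \<open>x\<close> iff
  \<open>l\<inverse> x r = l' x r'\<inverse>\<close>, so a pair \<open>(l', r')\<close> exists because \<open>L\<inverse>xR = LxR\<inverse>\<close>. For uniqueness one
  changes the base point: with \<open>y = l\<inverse> x r\<close> the equation reads \<open>l'\<inverse> y r' = x\<close>, and injectivity
  applies at \<open>y\<close>. At \<open>x\<close> one would instead have to compare \<open>L\<inverse>L\<close> with \<open>R\<inverse>R\<close>, about which the axioms
  say nothing directly.

  Finally, the product is \<open>g \<mapsto> (l l')\<inverse> g (r r')\<close>, which is the identity iff \<open>l l' = r r'\<close> is
  central. A central product is unchanged by swapping its two factors, so then \<open>l' l = r' r\<close> is a
  common central element of \<open>Ll\<close> and \<open>Rr\<close>. Conversely, such an element yields a pair whose product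
  with \<open>\<lambda>(l,r)\<close> is the identity and so fixes \<open>x\<close>; by uniqueness it is the pair \<open>(l', r')\<close>.
\<close>

lemma lr_perm_apply:
  "x \<in> carrier G \<Longrightarrow> lr_perm G l r x = inv\<^bsub>G\<^esub> l \<otimes>\<^bsub>G\<^esub> x \<otimes>\<^bsub>G\<^esub> r"
  by (simp add: lr_perm_def)

lemma (in group) lr_perm_Bij:
  assumes "l \<in> carrier G" "r \<in> carrier G"
  shows "lr_perm G l r \<in> Bij (carrier G)"
proof -
  have "l \<otimes> (inv l \<otimes> x) = x" "inv l \<otimes> (l \<otimes> x) = x" if "x \<in> carrier G" for x
    using assms that by (simp_all flip: m_assoc)
  then have "bij_betw (lr_perm G l r) (carrier G) (carrier G)"
    using assms
    by (intro bij_betw_byWitness[where f' = "lr_perm G (inv l) (inv r)"])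
       (auto simp: lr_perm_apply m_assoc)
  then show ?thesis
    by (simp add: Bij_def lr_perm_def)
qed

lemma perm_comp_apply:
  assumes "\<alpha> \<in> Bij (carrier G)" "\<beta> \<in> Bij (carrier G)" "x \<in> carrier G"
  shows "perm_comp G \<alpha> \<beta> x = \<beta> (\<alpha> x)"
  using assms by (simp add: perm_comp_def BijGroup_def compose_def)

lemma perm_comp_Bij:
  assumes "\<alpha> \<in> Bij (carrier G)" "\<beta> \<in> Bij (carrier G)"
  shows "perm_comp G \<alpha> \<beta> \<in> Bij (carrier G)"
  using assms by (simp add: perm_comp_def BijGroup_def compose_Bij)

lemma (in group) perm_comp_lr_perm:
  assumes "l \<in> carrier G" "r \<in> carrier G" "l' \<in> carrier G" "r' \<in> carrier G"
  shows "perm_comp G (lr_perm G l r) (lr_perm G l' r') = lr_perm G (l \<otimes> l') (r \<otimes> r')"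
proof (rule extensionalityI[where A = "carrier G"])
  show "perm_comp G (lr_perm G l r) (lr_perm G l' r') \<in> extensional (carrier G)"
    using perm_comp_Bij[OF lr_perm_Bij lr_perm_Bij] assms by (simp add: Bij_def)
  show "lr_perm G (l \<otimes> l') (r \<otimes> r') \<in> extensional (carrier G)"
    by (simp add: lr_perm_def)
  show "perm_comp G (lr_perm G l r) (lr_perm G l' r') x = lr_perm G (l \<otimes> l') (r \<otimes> r') x"
    if "x \<in> carrier G" for x
    using assms that
    by (simp add: perm_comp_apply lr_perm_Bij lr_perm_apply m_assoc inv_mult_group)
qed

lemma (in group) lr_perm_fixes_iff:
  assumes "l \<in> carrier G" "r \<in> carrier G" "x \<in> carrier G"
  shows "lr_perm G l r x = x \<longleftrightarrow> x \<otimes> r = l \<otimes> x"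
  using assms by (simp add: lr_perm_apply m_assoc inv_solve_left')

text \<open>Evaluating at \<open>\<one>\<close> forces the two parameters to agree; then \<open>\<lambda>(l,l)\<close> is conjugation by \<open>l\<close>.\<close>

lemma (in group) lr_perm_eq_one_iff:
  assumes "l \<in> carrier G" "r \<in> carrier G"
  shows "lr_perm G l r = \<one>\<^bsub>BijGroup (carrier G)\<^esub> \<longleftrightarrow> l = r \<and> l \<in> centre G"
proof -
  have "lr_perm G l r = \<one>\<^bsub>BijGroup (carrier G)\<^esub> \<longleftrightarrow> (\<forall>x\<in>carrier G. lr_perm G l r x = x)"
    by (auto simp: BijGroup_def lr_perm_def fun_eq_iff)
  also have "\<dots> \<longleftrightarrow> (\<forall>x\<in>carrier G. x \<otimes> r = l \<otimes> x)"
    using assms by (simp add: lr_perm_fixes_iff)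
  also have "\<dots> \<longleftrightarrow> l = r \<and> l \<in> centre G"
  proof
    assume *: "\<forall>x\<in>carrier G. x \<otimes> r = l \<otimes> x"
    then have "\<one> \<otimes> r = l \<otimes> \<one>"
      using one_closed by blast
    with * show "l = r \<and> l \<in> centre G"
      using assms by (simp add: centre_def)
  qed (auto simp: centre_def)
  finally show ?thesis .
qed

lemma (in group) central_mult_commute:
  assumes "a \<in> carrier G" "b \<in> carrier G" "a \<otimes> b \<in> centre G"
  shows "b \<otimes> a = a \<otimes> b"
proof -
  have "a \<otimes> (b \<otimes> a) = a \<otimes> (a \<otimes> b)"
    using assms by (simp add: centre_def flip: m_assoc)
  then show ?thesis
    using assms by simp
qed

lemma conj_setI: "x \<in> X \<Longrightarrow> inv\<^bsub>G\<^esub> g \<otimes>\<^bsub>G\<^esub> x \<otimes>\<^bsub>G\<^esub> g \<in> conj_set G X g"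
  by (auto simp: conj_set_def l_coset_def r_coset_def)

text \<open>
  If \<open>l\<inverse> x r = a\<inverse> x b\<close>, then \<open>r b\<inverse>\<close> is the conjugate of \<open>l a\<inverse>\<close> by \<open>x\<close>. It lies in \<open>RR\<inverse>\<close> and in a
  conjugate of \<open>LL\<inverse>\<close>, so it is trivial.
\<close>

lemma (in group) two_S_Cayley_inj:
  assumes "two_S_Cayley G L R" "L \<subseteq> carrier G" "R \<subseteq> carrier G"
    and "l \<in> L" "r \<in> R" "a \<in> L" "b \<in> R" "x \<in> carrier G"
    and eq: "lr_perm G l r x = lr_perm G a b x"
  shows "l = a \<and> r = b"
proof -
  have carr: "l \<in> carrier G" "r \<in> carrier G" "a \<in> carrier G" "b \<in> carrier G"
    using assms by auto
  have "inv l \<otimes> (x \<otimes> r) = inv a \<otimes> x \<otimes> b"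
    using eq carr assms(8) by (simp add: lr_perm_apply m_assoc)
  then have "x \<otimes> r = l \<otimes> inv a \<otimes> x \<otimes> b"
    using carr assms(8) by (simp add: inv_solve_left' m_assoc)
  then have "r = inv x \<otimes> (l \<otimes> inv a) \<otimes> x \<otimes> b"
    using carr assms(8) by (simp add: inv_solve_left m_assoc)
  then have conj: "inv x \<otimes> (l \<otimes> inv a) \<otimes> x = r \<otimes> inv b"
    using carr assms(8) by (simp add: inv_solve_right)
  have "l \<otimes> inv a \<in> L <#> set_inv L"
    using assms by (auto simp: set_mult_def SET_INV_def)
  then have "inv x \<otimes> (l \<otimes> inv a) \<otimes> x \<in> conj_set G (L <#> set_inv L) x"
    by (rule conj_setI)
  moreover have "r \<otimes> inv b \<in> R <#> set_inv R"
    using assms by (auto simp: set_mult_def SET_INV_def)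
  ultimately have "r \<otimes> inv b \<in> conj_set G (L <#> set_inv L) x \<inter> (R <#> set_inv R)"
    by (simp add: conj)
  then have "r \<otimes> inv b = \<one>"
    using assms(1,8) unfolding two_S_Cayley_def by blast
  then have "r = b"
    using carr by (simp add: inv_solve_right')
  with eq have "inv l = inv a"
    using carr assms(8) by (simp add: lr_perm_apply)
  with \<open>r = b\<close> show ?thesis
    using carr by (metis inv_inv)
qed

lemma (in group) lr_perm_derangement:
  assumes "two_S_Cayley G L R" "L \<subseteq> carrier G" "R \<subseteq> carrier G" "l \<in> L" "r \<in> R"
  shows "lr_perm G l r \<in> derangements G"
proof -
  have carr: "l \<in> carrier G" "r \<in> carrier G"
    using assms by auto
  have "lr_perm G l r x \<noteq> x" if x: "x \<in> carrier G" for x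
  proof
    assume "lr_perm G l r x = x"
    then have "r = inv x \<otimes> l \<otimes> x"
      using carr x by (simp add: lr_perm_fixes_iff inv_solve_left m_assoc)
    then have "r \<in> conj_set G L x \<inter> R"
      using conj_setI[OF assms(4), of G x] assms(5) by simp
    then show False
      using assms(1) x by (auto simp: two_S_Cayley_def)
  qed
  then show ?thesis
    using carr by (simp add: derangements_def lr_perm_Bij)
qed

text \<open>
  Composing with \<open>\<beta>\<close> turns a fixed point of \<open>\<alpha> \<beta>\<inverse>\<close> into a point where \<open>\<alpha>\<close> and \<open>\<beta>\<close> agree; this avoids
  any formula for the inverse of \<open>\<beta>\<close>.
\<close>

lemma (in group) quotient_derangement:
  assumes "two_S_Cayley G L R" "L \<subseteq> carrier G" "R \<subseteq> carrier G"
    and "\<alpha> \<in> connection_set G L R" "\<beta> \<in> connection_set G L R"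
    and ne: "perm_comp G \<alpha> (inv\<^bsub>BijGroup (carrier G)\<^esub> \<beta>) \<noteq> \<one>\<^bsub>BijGroup (carrier G)\<^esub>"
  shows "perm_comp G \<alpha> (inv\<^bsub>BijGroup (carrier G)\<^esub> \<beta>) \<in> derangements G"
proof -
  interpret B: group "BijGroup (carrier G)"
    by (rule group_BijGroup)
  obtain l r a b where \<alpha>: "\<alpha> = lr_perm G l r" "l \<in> L" "r \<in> R"
    and \<beta>: "\<beta> = lr_perm G a b" "a \<in> L" "b \<in> R"
    using assms(4,5) by (auto simp: connection_set_def)
  have carrB: "carrier (BijGroup (carrier G)) = Bij (carrier G)"
    by (simp add: BijGroup_def)
  have Bij: "\<alpha> \<in> Bij (carrier G)" "\<beta> \<in> Bij (carrier G)"
    using \<alpha> \<beta> assms(2,3) by (auto intro: lr_perm_Bij)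
  then have inv_Bij: "inv\<^bsub>BijGroup (carrier G)\<^esub> \<beta> \<in> Bij (carrier G)"
    using B.inv_closed[of \<beta>] carrB by simp
  let ?\<gamma> = "perm_comp G \<alpha> (inv\<^bsub>BijGroup (carrier G)\<^esub> \<beta>)"
  have \<gamma>: "?\<gamma> \<in> Bij (carrier G)"
    using Bij(1) inv_Bij by (rule perm_comp_Bij)
  have \<gamma>\<beta>: "perm_comp G ?\<gamma> \<beta> = \<alpha>"
    using Bij inv_Bij carrB by (simp add: perm_comp_def flip: B.m_assoc)
  have "?\<gamma> x \<noteq> x" if x: "x \<in> carrier G" for x
  proof
    assume fixed: "?\<gamma> x = x"
    have "\<alpha> x = perm_comp G ?\<gamma> \<beta> x"
      by (simp add: \<gamma>\<beta>)
    also have "\<dots> = \<beta> x"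
      using fixed \<gamma> Bij x by (simp add: perm_comp_apply)
    finally have "l = a \<and> r = b"
      using two_S_Cayley_inj[OF assms(1-3)] \<alpha> \<beta> x by blast
    then have "\<alpha> = \<beta>"
      using \<alpha> \<beta> by simp
    then have "?\<gamma> = \<one>\<^bsub>BijGroup (carrier G)\<^esub>"
      using Bij carrB by (simp add: perm_comp_def)
    with ne show False ..
  qed
  then show ?thesis
    using \<gamma> by (simp add: derangements_def)
qed

text \<open>
  Existence solves \<open>y = a x b\<inverse>\<close> at \<open>x\<close>, whereas uniqueness is injectivity of \<open>(a, b) \<mapsto> a\<inverse> y b\<close> at the
  intermediate point \<open>y = l\<inverse> x r\<close>.
\<close>

lemma (in group) ex1_return_pair:
  assumes C: "two_S_Cayley G L R" "L \<subseteq> carrier G" "R \<subseteq> carrier G"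
    and "l \<in> L" "r \<in> R" and x: "x \<in> carrier G"
  shows "\<exists>!p. p \<in> L \<times> R \<and> perm_comp G (lr_perm G l r) (lr_perm G (fst p) (snd p)) x = x"
proof -
  let ?y = "inv l \<otimes> x \<otimes> r"
  have carr: "l \<in> carrier G" "r \<in> carrier G" and y: "?y \<in> carrier G"
    using assms by auto
  have comp: "perm_comp G (lr_perm G l r) (lr_perm G a b) x = lr_perm G a b ?y"
    if "a \<in> L" "b \<in> R" for a b
    using that carr C(2,3) x by (simp add: perm_comp_apply lr_perm_Bij lr_perm_apply subset_iff)
  have "?y \<in> (set_inv L #> x) <#> R"
    using assms by (auto simp: set_mult_def SET_INV_def r_coset_def)
  also have "\<dots> = (L #> x) <#> set_inv R"
    using C(1) x by (simp add: two_S_Cayley_def)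
  finally obtain a b where ab: "a \<in> L" "b \<in> R" and y_eq: "?y = a \<otimes> x \<otimes> inv b"
    by (auto simp: set_mult_def SET_INV_def r_coset_def)
  have carr_ab: "a \<in> carrier G" "b \<in> carrier G"
    using ab C by auto
  have fix_ab: "lr_perm G a b ?y = x"
    unfolding y_eq using carr_ab x by (simp add: lr_perm_apply m_assoc inv_solve_left')
  show ?thesis
  proof (rule ex1I[of _ "(a, b)"])
    show "(a, b) \<in> L \<times> R \<and>
        perm_comp G (lr_perm G l r) (lr_perm G (fst (a, b)) (snd (a, b))) x = x"
      using ab fix_ab by (simp add: comp)
    fix p
    assume p: "p \<in> L \<times> R \<and> perm_comp G (lr_perm G l r) (lr_perm G (fst p) (snd p)) x = x"
    then have "lr_perm G (fst p) (snd p) ?y = lr_perm G a b ?y"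
      using fix_ab by (auto simp: comp)
    then show "p = (a, b)"
      using two_S_Cayley_inj[OF C _ _ ab y, of "fst p" "snd p"] p by (auto simp: prod_eq_iff)
  qed
qed

text \<open>
  The product of \<open>\<lambda>(l,r)\<close> and \<open>\<lambda>(l',r')\<close> involves \<open>l l'\<close> and \<open>r r'\<close>, but the cosets contain \<open>l' l\<close> and
  \<open>r' r\<close>; centrality lets the factors be swapped. A common central element of the cosets comes from
  some pair \<open>(a, b)\<close>, and only uniqueness at \<open>x\<close> identifies it with the given one.
\<close>

lemma (in group) return_pair_eq_one_iff:
  assumes C: "two_S_Cayley G L R" "L \<subseteq> carrier G" "R \<subseteq> carrier G"
    and "l \<in> L" "r \<in> R" "x \<in> carrier G" "l' \<in> L" "r' \<in> R"
    and fixed: "perm_comp G (lr_perm G l r) (lr_perm G l' r') x = x"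
  shows "perm_comp G (lr_perm G l r) (lr_perm G l' r') = \<one>\<^bsub>BijGroup (carrier G)\<^esub> \<longleftrightarrow>
    (L #> l) \<inter> (R #> r) \<inter> centre G \<noteq> {}"
proof
  have carr: "l \<in> carrier G" "r \<in> carrier G" "l' \<in> carrier G" "r' \<in> carrier G"
    using assms by auto
  {
    assume "perm_comp G (lr_perm G l r) (lr_perm G l' r') = \<one>\<^bsub>BijGroup (carrier G)\<^esub>"
    then have z: "l \<otimes> l' = r \<otimes> r'" "l \<otimes> l' \<in> centre G"
      using carr by (auto simp: perm_comp_lr_perm lr_perm_eq_one_iff)
    then have "l' \<otimes> l = l \<otimes> l'" "r' \<otimes> r = r \<otimes> r'"
      using carr central_mult_commute[of l l'] central_mult_commute[of r r'] by simp_all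
    moreover have "l' \<otimes> l \<in> L #> l" "r' \<otimes> r \<in> R #> r"
      using assms by (auto simp: r_coset_def)
    ultimately have "l \<otimes> l' \<in> (L #> l) \<inter> (R #> r) \<inter> centre G"
      using z by simp
    then show "(L #> l) \<inter> (R #> r) \<inter> centre G \<noteq> {}"
      by blast
  next
    assume "(L #> l) \<inter> (R #> r) \<inter> centre G \<noteq> {}"
    then obtain a b where ab: "a \<in> L" "b \<in> R" "a \<otimes> l = b \<otimes> r" "a \<otimes> l \<in> centre G"
      by (auto simp: r_coset_def)
    have carr_ab: "a \<in> carrier G" "b \<in> carrier G"
      using ab C by auto
    have "l \<otimes> a = r \<otimes> b" "l \<otimes> a \<in> centre G"
      using ab carr carr_ab central_mult_commute[of a l] central_mult_commute[of b r] by simp_all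
    then have one: "perm_comp G (lr_perm G l r) (lr_perm G a b) = \<one>\<^bsub>BijGroup (carrier G)\<^esub>"
      using carr carr_ab by (simp add: perm_comp_lr_perm lr_perm_eq_one_iff)
    then have "perm_comp G (lr_perm G l r) (lr_perm G a b) x = x"
      using assms(6) by (simp add: BijGroup_def)
    then have "(a, b) = (l', r')"
      using ex1_return_pair[OF C assms(4-6)] ab fixed assms(7,8)
      by (metis SigmaI fst_conv snd_conv)
    with one show "perm_comp G (lr_perm G l r) (lr_perm G l' r') = \<one>\<^bsub>BijGroup (carrier G)\<^esub>"
      by simp
  }
qed

theorem proposition3p3:
  fixes G :: "('a, 'b) monoid_scheme" and L R :: "'a set"
  assumes "group G"
    and "L \<subseteq> carrier G" and "R \<subseteq> carrier G"
    and "two_S_Cayley G L R"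
  shows "(\<forall>l\<in>L. \<forall>r\<in>R. \<forall>x\<in>carrier G.
            (\<exists>!p. p \<in> L \<times> R \<and>
               perm_comp G (lr_perm G l r) (lr_perm G (fst p) (snd p)) x = x) \<and>
            (\<forall>l'\<in>L. \<forall>r'\<in>R.
               perm_comp G (lr_perm G l r) (lr_perm G l' r') x = x \<longrightarrow>
               (perm_comp G (lr_perm G l r) (lr_perm G l' r') = \<one>\<^bsub>BijGroup (carrier G)\<^esub> \<longleftrightarrow>
                (L #>\<^bsub>G\<^esub> l) \<inter> (R #>\<^bsub>G\<^esub> r) \<inter> centre G \<noteq> {})))
       \<and> connection_set G L R \<subseteq> derangements G
       \<and> perm_set_comp G (connection_set G L R)
            (set_inv\<^bsub>BijGroup (carrier G)\<^esub> (connection_set G L R))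
            - {\<one>\<^bsub>BijGroup (carrier G)\<^esub>} \<subseteq> derangements G"
proof -
  interpret group G
    by (fact assms(1))
  note C = assms(4,2,3)
  have "perm_set_comp G (connection_set G L R)
      (set_inv\<^bsub>BijGroup (carrier G)\<^esub> (connection_set G L R))
      - {\<one>\<^bsub>BijGroup (carrier G)\<^esub>} \<subseteq> derangements G"
    using quotient_derangement[OF C] by (auto simp: perm_set_comp_def SET_INV_def)
  moreover have "connection_set G L R \<subseteq> derangements G"
    using lr_perm_derangement[OF C] by (auto simp: connection_set_def)
  ultimately show ?thesis
    by (intro conjI ballI impI ex1_return_pair[OF C] return_pair_eq_one_iff[OF C])
qed

end
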